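(* Let $s,t \geq 1$ be integers and let $\beta_{s,t}$ be the type-$\beta$ comb with $s$ teeth of length $t$. Then the number of linear extensions of $\beta_{s,t}$ that avoid both patterns $231$ and $321$ equals $t^{s-1}$.
   Context: A linear extension of a finite poset $P$ on a set of integers is a listing $v=[v_1,\dots,v_n]$ of all elements of $P$, each exactly once, such that whenever $a \leq_P b$, $a$ appears before $b$. For $w \in S_3$, a sequence $v$ of distinct integers contains $w$ if there are indices $i<j<k$ with $(v_i,v_j,v_k)$ in the same relative order as $(w_1,w_2,w_3)$; otherwise $v$ avoids $w$. The type-$\beta$ comb $\beta_{s,t}$ is the poset on $\{1,\dots,st\}$ whose order is generated by the relations $ct+1 \leq (c+1)t+1$ for $0 \leq c \leq s-2$ (the spine) and $ct+j \leq ct+j+1$ for $0 \leq c \leq s-1$, $1 \leq j \leq t-1$ (the teeth $\{ct+1,\dots,ct+t\}$). *)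

theory Defs
  imports Main
begin

text \<open>A finite poset is a carrier set together with its (reflexive) order relation \<open>r\<close>;
  a listing is a list, with positions counted from 0. As \<open>r\<close> is reflexive, ``appears before''
  is the weak comparison of positions.\<close>

definition linear_extension :: "'a set \<Rightarrow> ('a \<times> 'a) set \<Rightarrow> 'a list \<Rightarrow> bool" where
  "linear_extension A r v \<longleftrightarrow>
     distinct v \<and> set v = A \<and>
     (\<forall>i<length v. \<forall>j<length v. (v ! i, v ! j) \<in> r \<longrightarrow> i \<le> j)"

definition same_relative_order :: "'a::linorder list \<Rightarrow> 'b::linorder list \<Rightarrow> bool" where
  "same_relative_order xs ys \<longleftrightarrow>
     length xs = length ys \<and>
     (\<forall>a<length xs. \<forall>b<length xs. xs ! a < xs ! b \<longleftrightarrow> ys ! a < ys ! b)"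

text \<open>The pattern \<open>w\<close> is a permutation of \<open>{1, 2, 3}\<close> in one-line notation.\<close>

definition contains_pattern :: "'a::linorder list \<Rightarrow> nat list \<Rightarrow> bool" where
  "contains_pattern v w \<longleftrightarrow>
     (\<exists>i j k. i < j \<and> j < k \<and> k < length v \<and> same_relative_order [v ! i, v ! j, v ! k] w)"

definition avoids :: "'a::linorder list \<Rightarrow> nat list \<Rightarrow> bool" where
  "avoids v w \<longleftrightarrow> \<not> contains_pattern v w"

definition comb_carrier :: "nat \<Rightarrow> nat \<Rightarrow> nat set" where
  "comb_carrier s t = {1..s * t}"

text \<open>The bounds \<open>c \<le> s - 2\<close> and \<open>j \<le> t - 1\<close> are written without
  truncated subtraction, so that there is no spine relation for \<open>s = 1\<close>.\<close>

definition comb_spine :: "nat \<Rightarrow> nat \<Rightarrow> (nat \<times> nat) set" where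
  "comb_spine s t = {(c * t + 1, (c + 1) * t + 1) | c. c + 2 \<le> s}"

definition comb_teeth :: "nat \<Rightarrow> nat \<Rightarrow> (nat \<times> nat) set" where
  "comb_teeth s t = {(c * t + j, c * t + j + 1) | c j. c + 1 \<le> s \<and> 1 \<le> j \<and> j + 1 \<le> t}"

definition comb_order :: "nat \<Rightarrow> nat \<Rightarrow> (nat \<times> nat) set" where
  "comb_order s t =
     (comb_spine s t \<union> comb_teeth s t)\<^sup>* \<inter> (comb_carrier s t \<times> comb_carrier s t)"

lemma comb_order_le:
  assumes "t \<ge> 1" "(a, b) \<in> comb_order s t"
  shows "a \<le> b"
proof -
  have "(a, b) \<in> (comb_spine s t \<union> comb_teeth s t)\<^sup>*"
    using assms(2) by (simp add: comb_order_def)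
  then show ?thesis
    by (induction rule: rtrancl_induct) (auto simp: comb_spine_def comb_teeth_def)
qed

lemma partial_order_on_comb_order:
  assumes "t \<ge> 1"
  shows "partial_order_on (comb_carrier s t) (comb_order s t)"
proof -
  have "antisym (comb_order s t)"
    using comb_order_le[OF assms] by (meson antisymI order_antisym)
  moreover have "trans (comb_order s t)"
    unfolding comb_order_def by (rule transI) (auto intro: rtrancl_trans)
  moreover have "refl_on (comb_carrier s t) (comb_order s t)"
    by (auto simp: refl_on_def comb_order_def)
  ultimately show ?thesis
    by (auto simp: partial_order_on_def preorder_on_def comb_order_def)
qed

end

theory Submission
  imports Defs "HOL-Library.FuncSet"
begin

text \<open>Compare an element \<open>y\<close> with the smaller elements that follow it in an admissible listing.
  If \<open>a < y\<close> precedes \<open>y\<close>, avoiding 231 forces every smaller element \<open>x\<close> following \<open>y\<close> to satisfy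
  \<open>a < x\<close>. A non-spine \<open>y\<close> is preceded by \<open>y - 1\<close>, so no smaller element follows it; a
  spine element \<open>c * t + 1\<close> is preceded by \<open>(c - 1) * t + 1\<close>, so it can only be moved ahead of a final
  segment of the tooth below it, and the length \<open>f c < t\<close> of that segment is arbitrary. The
  numbers \<open>f 1, \<dots>, f (s - 1)\<close> determine the listing, which is \<open>1, \<dots>, s * t\<close> sorted by a key
  that shifts each spine element \<open>f c\<close> places to the left.\<close>

section \<open>Positions in a listing\<close>

text \<open>On a distinct listing this inverts \<open>nth\<close>, so that order and patterns can be
  discussed through elements instead of indices.\<close>

definition pos :: "'a list \<Rightarrow> 'a \<Rightarrow> nat" where
  "pos v x = (LEAST i. i < length v \<and> v ! i = x)"

lemma pos_props:
  assumes "x \<in> set v"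
  shows "pos v x < length v" "v ! pos v x = x"
proof -
  obtain i where "i < length v \<and> v ! i = x"
    using assms by (metis in_set_conv_nth)
  then have "pos v x < length v \<and> v ! pos v x = x"
    unfolding pos_def by (rule LeastI)
  then show "pos v x < length v" "v ! pos v x = x" by auto
qed

lemma pos_nth: "distinct v \<Longrightarrow> i < length v \<Longrightarrow> pos v (v ! i) = i"
  using pos_props[of "v ! i" v] by (simp add: nth_eq_iff_index_eq)

lemma pos_eq_iff: "x \<in> set v \<Longrightarrow> y \<in> set v \<Longrightarrow> pos v x = pos v y \<longleftrightarrow> x = y"
  by (metis pos_props(2))

lemma linear_extension_iff_pos:
  "linear_extension A r v \<longleftrightarrow>
     distinct v \<and> set v = A \<and> (\<forall>x\<in>A. \<forall>y\<in>A. (x, y) \<in> r \<longrightarrow> pos v x \<le> pos v y)"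
  (is "?L \<longleftrightarrow> ?R")
proof
  assume L: ?L
  show ?R
    using L pos_props[of _ v] unfolding linear_extension_def by metis
next
  assume R: ?R
  then show ?L
    unfolding linear_extension_def using pos_nth nth_mem by metis
qed

lemma same_relative_order_231:
  "same_relative_order [x, y, z] [2, 3, 1 :: nat] \<longleftrightarrow> z < x \<and> x < y"
  by (auto simp: same_relative_order_def All_less_Suc numeral_3_eq_3 less_Suc_eq)

lemma same_relative_order_321:
  "same_relative_order [x, y, z] [3, 2, 1 :: nat] \<longleftrightarrow> z < y \<and> y < x"
  by (auto simp: same_relative_order_def All_less_Suc numeral_3_eq_3 less_Suc_eq)

lemma contains_pattern_iff_pos:
  assumes "distinct v"
  shows "contains_pattern v w \<longleftrightarrow>
    (\<exists>x\<in>set v. \<exists>y\<in>set v. \<exists>z\<in>set v. pos v x < pos v y \<and> pos v y < pos v z \<and>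
       same_relative_order [x, y, z] w)"
  (is "?L \<longleftrightarrow> ?R")
proof
  assume ?L
  then obtain i j k where "i < j" "j < k" "k < length v"
    "same_relative_order [v ! i, v ! j, v ! k] w"
    unfolding contains_pattern_def by blast
  then show ?R
    using assms by (intro bexI[of _ "v ! i"] bexI[of _ "v ! j"] bexI[of _ "v ! k"])
      (simp_all add: pos_nth)
next
  assume ?R
  then show ?L
    unfolding contains_pattern_def by (metis pos_props)
qed

lemma pos_less_iff_key_less:
  fixes k :: "'a \<Rightarrow> 'b::linorder"
  assumes "sorted (map k v)" "inj_on k (set v)" "x \<in> set v" "y \<in> set v"
  shows "pos v x < pos v y \<longleftrightarrow> k x < k y"
proof -
  have mono: "k a \<le> k b" if "pos v a \<le> pos v b" "a \<in> set v" "b \<in> set v" for a b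
    using sorted_nth_mono[OF assms(1) that(1)] pos_props that by force
  show ?thesis
    using mono[of x y] mono[of y x] assms pos_eq_iff[of x v y] inj_onD[OF assms(2), of x y]
    by (metis leD leI nle_le)
qed

text \<open>The hypothesis \<open>less\<close> makes \<open>v\<close> sorted by \<open>k\<close>,
  and a set has only one sorted listing under a key injective on it. A listing is thus recovered
  from its pairwise precedences.\<close>

lemma sort_key_eqI:
  fixes k :: "'a \<Rightarrow> 'b::linorder"
  assumes "distinct v" "distinct xs" "set v = set xs" "inj_on k (set v)"
    and less: "\<And>x y. x \<in> set v \<Longrightarrow> y \<in> set v \<Longrightarrow> pos v x < pos v y \<Longrightarrow> k x < k y"
  shows "sort_key k xs = v"
proof -
  have "sorted (map k v)"
    unfolding sorted_iff_nth_mono_less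
    using less[of "v ! i" "v ! j" for i j] assms(1) by (auto simp: pos_nth intro!: less_imp_le)
  then have "map k (sort_key k xs) = map k v"
    using assms by (intro sorted_distinct_set_unique) (auto simp: distinct_map)
  then show ?thesis
    using assms by (intro map_inj_on[of k]) auto
qed

section \<open>The sorting key of a shift vector\<close>

text \<open>The odd values keep a shifted spine element apart from the tooth elements around it. The
  root 1 is never shifted.\<close>

definition shift_key :: "nat \<Rightarrow> (nat \<Rightarrow> nat) \<Rightarrow> nat \<Rightarrow> nat" where
  "shift_key t f x =
     (if t dvd x - 1 \<and> x \<noteq> 1 then 2 * x - 1 - 2 * f ((x - 1) div t) else 2 * x)"

text \<open>Meant for \<open>x < y\<close>: the predicted inversions, where the larger
  \<open>y\<close> is listed before \<open>x\<close>.\<close>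

definition shifted :: "nat \<Rightarrow> nat \<Rightarrow> (nat \<Rightarrow> nat) \<Rightarrow> nat \<Rightarrow> nat \<Rightarrow> bool" where
  "shifted s t f x y \<longleftrightarrow> (\<exists>c\<in>{1..<s}. y = c * t + 1 \<and> y \<le> x + f c)"

lemma mult_neq_mult_add:
  fixes c d t i :: nat
  assumes "1 \<le> i" "i < t"
  shows "d * t \<noteq> c * t + i"
proof
  assume "d * t = c * t + i"
  then have "(c * t + i) mod t = 0"
    by (metis mod_mult_self2_is_0)
  then show False using assms by simp
qed

lemma not_shifted_tooth:
  assumes "2 \<le> j" "j \<le> t"
  shows "\<not> shifted s t f x (c * t + j)"
proof
  assume "shifted s t f x (c * t + j)"
  then obtain d where "c * t + j = d * t + 1" by (auto simp: shifted_def)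
  then have "d * t = c * t + (j - 1)" using assms by simp
  moreover have "d * t \<noteq> c * t + (j - 1)"
    using assms by (intro mult_neq_mult_add) auto
  ultimately show False by blast
qed

lemma comb_element_cases:
  fixes s t x :: nat
  assumes "t \<ge> 1" "x \<in> {1..s * t}"
  obtains (root) "x = 1"
  | (spine) c where "c \<in> {1..<s}" "x = c * t + 1"
  | (tooth) c j where "c < s" "2 \<le> j" "j \<le> t" "x = c * t + j"
proof -
  define c where "c = (x - 1) div t"
  define j where "j = (x - 1) mod t + 1"
  have x: "x = c * t + j"
    using assms by (simp add: c_def j_def)
  have c: "c < s"
    using assms by (auto simp: c_def div_less_iff_less_mult)
  have j: "1 \<le> j" "j \<le> t"
    using assms by (auto simp: j_def Suc_le_eq)
  consider "j \<ge> 2" | "j = 1" "c = 0" | "j = 1" "c \<ge> 1"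
    using j by linarith
  then show thesis
    using x c j root spine tooth by cases auto
qed

lemma shift_key_simps:
  assumes "t \<ge> 1"
  shows "shift_key t f 1 = 2"
    and "c \<ge> 1 \<Longrightarrow> shift_key t f (c * t + 1) = 2 * (c * t) + 1 - 2 * f c"
    and "2 \<le> j \<Longrightarrow> j \<le> t \<Longrightarrow> shift_key t f (c * t + j) = 2 * (c * t + j)"
proof -
  show "shift_key t f 1 = 2"
    by (simp add: shift_key_def)
  show "shift_key t f (c * t + 1) = 2 * (c * t) + 1 - 2 * f c" if "c \<ge> 1"
    using assms that by (simp add: shift_key_def)
  show "shift_key t f (c * t + j) = 2 * (c * t + j)" if "2 \<le> j" "j \<le> t"
  proof -
    have "c * t + j - 1 = (j - 1) + c * t" using that by simp
    then have "(c * t + j - 1) mod t = j - 1"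
      using that by (simp only: mod_mult_self1) simp
    then have "\<not> t dvd c * t + j - 1"
      using that by (simp add: dvd_eq_mod_eq_0)
    then show ?thesis
      by (simp add: shift_key_def)
  qed
qed

lemma shift_key_le: "shift_key t f x \<le> 2 * x"
  by (simp add: shift_key_def)

text \<open>Keys never exceed \<open>2 * x\<close>, so an unmoved \<open>y\<close> stays behind
  everything smaller. A spine element moves fewer than \<open>t\<close> places, hence passes only
  elements of the tooth just below it, where an odd key meets even ones.\<close>

lemma shift_key_compare:
  assumes "t \<ge> 1" and f: "\<And>c. c \<in> {1..<s} \<Longrightarrow> f c < t"
    and x: "x \<in> {1..s * t}" and y: "y \<in> {1..s * t}" and "x < y"
  shows "if shifted s t f x y then shift_key t f y < shift_key t f x
         else shift_key t f x < shift_key t f y"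
  using \<open>t \<ge> 1\<close> y
proof (cases rule: comb_element_cases)
  case root
  then show ?thesis using x \<open>x < y\<close> by simp
next
  case (tooth c j)
  have "\<not> shifted s t f x y"
    using not_shifted_tooth tooth by simp
  moreover have "shift_key t f y = 2 * y"
    using shift_key_simps(3)[OF \<open>t \<ge> 1\<close>] tooth by simp
  ultimately show ?thesis
    using shift_key_le[of t f x] \<open>x < y\<close> by simp
next
  case (spine c)
  have fc: "f c < t" using f spine by simp
  have sh: "shifted s t f x y \<longleftrightarrow> y \<le> x + f c"
    using spine \<open>t \<ge> 1\<close> by (auto simp: shifted_def)
  have ky: "shift_key t f y = 2 * (c * t) + 1 - 2 * f c"
    using shift_key_simps(2)[OF \<open>t \<ge> 1\<close>] spine by simp
  have ct: "t \<le> c * t" using spine by simp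
  \<comment> \<open>Here \<open>x\<close> is at most the previous spine element. As
    \<open>f c \<le> t - 1\<close>, the key of \<open>y\<close> is at least
    \<open>2 * (c * t + 1 - t) + 1\<close>, which exceeds \<open>2 * x\<close>.\<close>
  have low: ?thesis if "x + t \<le> c * t + 1"
    using that fc ct sh ky spine(2) shift_key_le[of t f x] by simp
  show ?thesis
    using \<open>t \<ge> 1\<close> x
  proof (cases rule: comb_element_cases)
    case root
    then show ?thesis using low ct by simp
  next
    case s2: (spine d)
    have "d * t < c * t" using s2 spine \<open>x < y\<close> by simp
    then have "Suc d \<le> c" by simp
    then have "Suc d * t \<le> c * t" by (rule mult_le_mono1)
    then show ?thesis using low s2 by simp
  next
    case (tooth d j)
    have "shift_key t f x = 2 * x"
      using shift_key_simps(3)[OF \<open>t \<ge> 1\<close>] tooth by simp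
    \<comment> \<open>The sum avoids truncated subtraction. By parity,
      \<open>2 * (c * t) + 1 < 2 * (x + f c)\<close> means
      \<open>c * t + 1 \<le> x + f c\<close>.\<close>
    moreover have "shift_key t f y + 2 * f c = 2 * (c * t) + 1"
      using ky fc ct by linarith
    ultimately show ?thesis
      unfolding sh using spine(2) by auto
  qed
qed

lemma inj_on_shift_key:
  assumes "t \<ge> 1" "\<And>c. c \<in> {1..<s} \<Longrightarrow> f c < t"
  shows "inj_on (shift_key t f) {1..s * t}"
proof (rule inj_onI)
  have neq: "shift_key t f x \<noteq> shift_key t f y"
    if "x \<in> {1..s * t}" "y \<in> {1..s * t}" "x < y" for x y
    using shift_key_compare[of t s f x y] assms that by (metis less_irrefl)
  fix x y
  assume "x \<in> {1..s * t}" "y \<in> {1..s * t}" "shift_key t f x = shift_key t f y"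
  then show "x = y"
    using neq[of x y] neq[of y x] by (metis linorder_neqE_nat)
qed

section \<open>Admissible listings and shift vectors\<close>

definition comb_listing :: "nat \<Rightarrow> nat \<Rightarrow> (nat \<Rightarrow> nat) \<Rightarrow> nat list" where
  "comb_listing s t f = sort_key (shift_key t f) [1..<s * t + 1]"

definition admissible :: "nat \<Rightarrow> nat \<Rightarrow> nat list \<Rightarrow> bool" where
  "admissible s t v \<longleftrightarrow> linear_extension (comb_carrier s t) (comb_order s t) v
     \<and> avoids v [2, 3, 1] \<and> avoids v [3, 2, 1]"

lemma set_comb_listing: "set (comb_listing s t f) = {1..s * t}"
  by (simp add: comb_listing_def atLeastLessThanSuc_atLeastAtMost del: upt_Suc)

lemma distinct_comb_listing: "distinct (comb_listing s t f)"
  by (simp add: comb_listing_def)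

lemma pos_comb_listing:
  assumes "t \<ge> 1" "\<And>c. c \<in> {1..<s} \<Longrightarrow> f c < t" "x \<in> {1..s * t}" "y \<in> {1..s * t}"
  shows "pos (comb_listing s t f) x < pos (comb_listing s t f) y
     \<longleftrightarrow> shift_key t f x < shift_key t f y"
proof (rule pos_less_iff_key_less)
  show "sorted (map (shift_key t f) (comb_listing s t f))"
    by (simp add: comb_listing_def)
  show "inj_on (shift_key t f) (set (comb_listing s t f))"
    using inj_on_shift_key[of t s f] assms by (simp add: set_comb_listing)
qed (use assms in \<open>simp_all add: set_comb_listing\<close>)

lemma pos_comb_listing_inversion:
  assumes "t \<ge> 1" "\<And>c. c \<in> {1..<s} \<Longrightarrow> f c < t" "x \<in> {1..s * t}" "y \<in> {1..s * t}" "x < y"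
  shows "pos (comb_listing s t f) y < pos (comb_listing s t f) x \<longleftrightarrow> shifted s t f x y"
  using shift_key_compare[of t s f x y] pos_comb_listing[of t s f y x] assms
  by (auto split: if_splits)

lemma spine_in_carrier:
  fixes c s t :: nat
  assumes "t \<ge> 1" "c < s"
  shows "c * t + 1 \<in> {1..s * t}"
  using mult_le_mono1[of "Suc c" s t] assms by simp

lemma tooth_in_carrier:
  fixes c s t j :: nat
  assumes "c < s" "1 \<le> j" "j \<le> t"
  shows "c * t + j \<in> {1..s * t}"
  using mult_le_mono1[of "Suc c" s t] assms by simp

lemma shifted_gt_previous_spine:
  assumes "t \<ge> 1" "shifted s t f x (c * t + 1)" "c \<ge> 1" "\<And>c. c \<in> {1..<s} \<Longrightarrow> f c < t"
  shows "(c - 1) * t + 1 < x"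
proof -
  have "f c < t" "c * t + 1 \<le> x + f c"
    using assms by (auto simp: shifted_def)
  moreover have "c * t = (c - 1) * t + t"
    using \<open>c \<ge> 1\<close> by (cases c) auto
  ultimately show ?thesis by linarith
qed

text \<open>Tooth elements are never moved forward and a spine element never reaches its
  predecessor, so every generating relation is respected. For the patterns, an element passed by two
  spine elements would have to lie above the lower of them.\<close>

lemma admissible_comb_listing:
  assumes "t \<ge> 1" and f: "\<And>c. c \<in> {1..<s} \<Longrightarrow> f c < t"
  shows "admissible s t (comb_listing s t f)"
proof -
  let ?v = "comb_listing s t f"
  have inversion: "pos ?v y < pos ?v x \<longleftrightarrow> shifted s t f x y"
    if "x \<in> {1..s * t}" "y \<in> {1..s * t}" "x < y" for x y
    using pos_comb_listing_inversion[of t s f x y] assms that by blast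
  have less: "pos ?v x < pos ?v y"
    if "x \<in> {1..s * t}" "y \<in> {1..s * t}" "x < y" "\<not> shifted s t f x y" for x y
    using inversion[OF that(1-3)] that pos_eq_iff[of x ?v y]
    by (metis nat_neq_iff set_comb_listing)
  have gen: "pos ?v x < pos ?v y" if "(x, y) \<in> comb_spine s t \<union> comb_teeth s t" for x y
    using that
  proof
    assume "(x, y) \<in> comb_spine s t"
    then obtain c where c: "x = c * t + 1" "y = (c + 1) * t + 1" "c + 2 \<le> s"
      by (auto simp: comb_spine_def)
    have "\<not> shifted s t f x ((c + 1) * t + 1)"
      using shifted_gt_previous_spine[of t s f x "c + 1"] c assms by auto
    then show ?thesis
      using less[of x y] c spine_in_carrier[OF \<open>t \<ge> 1\<close>, of c s]
        spine_in_carrier[OF \<open>t \<ge> 1\<close>, of "c + 1" s] \<open>t \<ge> 1\<close> by simp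
  next
    assume "(x, y) \<in> comb_teeth s t"
    then obtain c j where c: "x = c * t + j" "y = c * t + (j + 1)" "c < s" "1 \<le> j" "j + 1 \<le> t"
      by (auto simp: comb_teeth_def)
    show ?thesis
      using less[of x y] c not_shifted_tooth[of "j + 1" t] tooth_in_carrier[of c s j t]
        tooth_in_carrier[of c s "j + 1" t] by simp
  qed
  have "pos ?v x \<le> pos ?v y" if "(x, y) \<in> comb_order s t" for x y
  proof -
    have "(x, y) \<in> (comb_spine s t \<union> comb_teeth s t)\<^sup>*"
      using that by (simp add: comb_order_def)
    then show ?thesis
      by (induction rule: rtrancl_induct) (use gen in force)+
  qed
  then have "linear_extension (comb_carrier s t) (comb_order s t) ?v"
    by (simp add: linear_extension_iff_pos distinct_comb_listing set_comb_listing
        comb_carrier_def)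
  \<comment> \<open>The order between \<open>x\<close> and \<open>y\<close> in the listing is left
    open, so this excludes 231 and 321 at once.\<close>
  moreover have two: False
    if "x \<in> {1..s * t}" "y \<in> {1..s * t}" "z \<in> {1..s * t}" "z < x" "z < y" "x < y"
      "pos ?v x < pos ?v z" "pos ?v y < pos ?v z" for x y z
  proof -
    have "shifted s t f z x" "shifted s t f z y"
      using inversion that by auto
    then obtain c d where "c \<in> {1..<s}" "d \<in> {1..<s}" "x = c * t + 1" "y = d * t + 1"
      unfolding shifted_def by blast
    then have c: "x = c * t + 1" "1 \<le> c" "y = d * t + 1" "1 \<le> d"
      by simp_all
    have "(d - 1) * t + 1 < z"
      using shifted_gt_previous_spine[of t s f z d] c \<open>shifted s t f z y\<close> assms by auto
    moreover have "c \<le> d - 1"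
      using \<open>x < y\<close> c by auto
    then have "c * t \<le> (d - 1) * t" by (rule mult_le_mono1)
    ultimately show False using c \<open>z < x\<close> by linarith
  qed
  have "avoids ?v [2, 3, 1]"
    unfolding avoids_def contains_pattern_iff_pos[OF distinct_comb_listing]
      same_relative_order_231 set_comb_listing
    using two by (meson less_trans)
  moreover have "avoids ?v [3, 2, 1]"
    unfolding avoids_def contains_pattern_iff_pos[OF distinct_comb_listing]
      same_relative_order_321 set_comb_listing
    using two by (meson less_trans)
  ultimately show ?thesis
    by (simp add: admissible_def)
qed

text \<open>The shift vector is read off from the sets of smaller elements that follow each spine
  element. Each such set is a final segment of a tooth, so one number describes it; the resulting
  inversions then determine the listing.\<close>

lemma admissible_imp_comb_listing:
  assumes "t \<ge> 1" and v: "admissible s t v"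
  shows "\<exists>f \<in> {1..<s} \<rightarrow>\<^sub>E {..<t}. v = comb_listing s t f"
proof -
  let ?A = "{1..s * t}"
  have dist: "distinct v" and set: "set v = ?A"
    and ext: "\<And>x y. x \<in> ?A \<Longrightarrow> y \<in> ?A \<Longrightarrow> (x, y) \<in> comb_order s t \<Longrightarrow> pos v x \<le> pos v y"
    using v by (auto simp: admissible_def linear_extension_iff_pos comb_carrier_def)
  have gen: "pos v x < pos v y"
    if "(x, y) \<in> comb_spine s t \<union> comb_teeth s t" "x \<in> ?A" "y \<in> ?A" "x < y" for x y
  proof -
    have "(x, y) \<in> comb_order s t"
      using that by (auto simp: comb_order_def comb_carrier_def)
    then show ?thesis
      using ext[of x y] that pos_eq_iff[of x v y] set by fastforce
  qed
  have spine: "pos v ((c - 1) * t + 1) < pos v (c * t + 1)" if "c \<in> {1..<s}" for c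
  proof (rule gen)
    show "((c - 1) * t + 1, c * t + 1) \<in> comb_spine s t \<union> comb_teeth s t"
      using that by (cases c) (auto simp: comb_spine_def)
    show "(c - 1) * t + 1 \<in> ?A" "c * t + 1 \<in> ?A"
      using spine_in_carrier[OF \<open>t \<ge> 1\<close>, of "c - 1" s] spine_in_carrier[OF \<open>t \<ge> 1\<close>, of c s] that
      by auto
    show "(c - 1) * t + 1 < c * t + 1"
      using that \<open>t \<ge> 1\<close> by (cases c) auto
  qed
  have tooth_step: "pos v (c * t + j) < pos v (c * t + Suc j)"
    if "c < s" "1 \<le> j" "Suc j \<le> t" for c j
  proof (rule gen)
    show "(c * t + j, c * t + Suc j) \<in> comb_spine s t \<union> comb_teeth s t"
      unfolding comb_teeth_def using that
      by (intro UnI2 CollectI exI[of _ c] exI[of _ j]) auto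
  qed (use that tooth_in_carrier[of c s j t] tooth_in_carrier[of c s "Suc j" t] in auto)
  have tooth: "pos v (c * t + i) \<le> pos v (c * t + j)"
    if "i \<le> j" "c < s" "1 \<le> i" "j \<le> t" for c i j
    using that
  proof (induction j rule: dec_induct)
    case (step j)
    then show ?case using tooth_step[of c j] by simp
  qed simp
  \<comment> \<open>If \<open>x < a\<close>, then \<open>a\<close>, \<open>b\<close>,
    \<open>x\<close> would form a 231.\<close>
  have lower: "a \<le> x"
    if "a \<in> ?A" "b \<in> ?A" "x \<in> ?A" "a < b" "pos v a < pos v b" "pos v b < pos v x" for a b x
    using v that unfolding admissible_def avoids_def contains_pattern_iff_pos[OF dist]
      same_relative_order_231 set by (meson leI)
  define S where "S c = {x \<in> ?A. x < c * t + 1 \<and> pos v (c * t + 1) < pos v x}" for c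
  \<comment> \<open>The distance from the spine element down to the least element of
    \<open>S c\<close>, or 0 if \<open>S c\<close> is empty. Once \<open>S c\<close> is known to be
    a final segment, this is its size.\<close>
  define g where "g c = (LEAST k. \<forall>x\<in>S c. c * t + 1 \<le> x + k)" for c
  have S_low: "(c - 1) * t + 1 < x" if "c \<in> {1..<s}" "x \<in> S c" for c x
  proof -
    have "(c - 1) * t + 1 \<le> x"
      using spine[OF that(1)] that spine_in_carrier[OF \<open>t \<ge> 1\<close>, of "c - 1" s] \<open>t \<ge> 1\<close>
        spine_in_carrier[OF \<open>t \<ge> 1\<close>, of c s]
      by (intro lower[of _ "c * t + 1"]) (auto simp: S_def)
    moreover have "(c - 1) * t + 1 \<noteq> x"
      using spine[OF that(1)] that by (auto simp: S_def)
    ultimately show ?thesis by simp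
  qed
  have prev: "c * t = (c - 1) * t + t" if "c \<in> {1..<s}" for c
    using that by (cases c) auto
  \<comment> \<open>By \<open>S_low\<close>, \<open>x\<close> and \<open>y\<close> both lie in tooth
    \<open>c - 1\<close>, so \<open>y\<close> does not precede \<open>x\<close> and also follows the
    spine element.\<close>
  have S_up: "y \<in> S c" if c: "c \<in> {1..<s}" and "x \<in> S c" "x \<le> y" "y < c * t + 1" for c x y
  proof -
    have "pos v ((c - 1) * t + (x - (c - 1) * t)) \<le> pos v ((c - 1) * t + (y - (c - 1) * t))"
      using S_low[OF c \<open>x \<in> S c\<close>] prev[OF c] that by (intro tooth) auto
    then have "pos v x \<le> pos v y"
      using S_low[OF c \<open>x \<in> S c\<close>] that by simp
    then show ?thesis
      using that spine_in_carrier[OF \<open>t \<ge> 1\<close>, of c s] by (auto simp: S_def)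
  qed
  \<comment> \<open>This gives both the existence of the \<open>LEAST\<close> value and the bound
    \<open>g c < t\<close>.\<close>
  have g_bound: "\<forall>x\<in>S c. c * t + 1 \<le> x + (t - 1)" if "c \<in> {1..<s}" for c
    using S_low[OF that] prev[OF that] \<open>t \<ge> 1\<close> by fastforce
  have g_less: "g c < t" if "c \<in> {1..<s}" for c
    using Least_le[of "\<lambda>k. \<forall>x\<in>S c. c * t + 1 \<le> x + k", OF g_bound[OF that]] \<open>t \<ge> 1\<close>
    by (simp add: g_def)
  have g_S: "c * t + 1 \<le> x + g c" if "c \<in> {1..<s}" "x \<in> S c" for c x
    using LeastI[of "\<lambda>k. \<forall>x\<in>S c. c * t + 1 \<le> x + k", OF g_bound[OF that(1)]] that
    by (simp add: g_def)
  have S_g: "x \<in> S c" if c: "c \<in> {1..<s}" and "x < c * t + 1" "c * t + 1 \<le> x + g c" for c x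
  proof -
    \<comment> \<open>The assumptions force \<open>g c > 0\<close>. Minimality then yields a
      \<open>y\<close> in \<open>S c\<close> with \<open>y \<le> x\<close>, and \<open>S_up\<close>
      carries membership up to \<open>x\<close>.\<close>
    have "g c - 1 < g c" using that by simp
    then have "\<not> (\<forall>x\<in>S c. c * t + 1 \<le> x + (g c - 1))"
      unfolding g_def by (rule not_less_Least)
    then obtain y where "y \<in> S c" "y + (g c - 1) < c * t + 1"
      by (auto simp: not_le)
    then show ?thesis
      using that S_up[OF c, of y x] by simp
  qed
  \<comment> \<open>Restriction fixes the values outside the index range, so that \<open>f\<close>
    lies in the extensional function space that is counted.\<close>
  define f where "f = restrict g {1..<s}"
  have f_less: "f c < t" if "c \<in> {1..<s}" for c
    using g_less that by (simp add: f_def)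
  have inv: "pos v y < pos v x \<longleftrightarrow> shifted s t f x y" if "x \<in> ?A" "y \<in> ?A" "x < y" for x y
    using \<open>t \<ge> 1\<close> \<open>y \<in> ?A\<close>
  proof (cases rule: comb_element_cases)
    case root
    then show ?thesis using that by simp
  next
    case (spine c)
    have "pos v y < pos v x \<longleftrightarrow> x \<in> S c"
      using that spine by (simp add: S_def)
    also have "\<dots> \<longleftrightarrow> y \<le> x + g c"
      using g_S S_g spine \<open>x < y\<close> by blast
    also have "\<dots> \<longleftrightarrow> shifted s t f x y"
      using spine \<open>t \<ge> 1\<close> by (auto simp: shifted_def f_def)
    finally show ?thesis .
  next
    case (tooth c j)
    have "y - 1 = c * t + (j - 1)" using tooth by simp
    then have before: "pos v (y - 1) < pos v y" and "y - 1 \<in> ?A"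
      using tooth_step[of c "j - 1"] tooth_in_carrier[of c s "j - 1" t] tooth by auto
    \<comment> \<open>Since \<open>y - 1\<close> precedes \<open>y\<close>, a smaller element
      following \<open>y\<close> is at least \<open>y - 1\<close> by \<open>lower\<close>, hence
      equal to it, although \<open>y - 1\<close> comes first.\<close>
    have "\<not> pos v y < pos v x"
    proof
      assume "pos v y < pos v x"
      then have "y - 1 \<le> x"
        using lower[of "y - 1" y x] before \<open>y - 1 \<in> ?A\<close> that by simp
      then have "x = y - 1" using \<open>x < y\<close> by simp
      then show False using before \<open>pos v y < pos v x\<close> by simp
    qed
    then show ?thesis
      using not_shifted_tooth tooth by simp
  qed
  have "sort_key (shift_key t f) [1..<s * t + 1] = v"
  proof (rule sort_key_eqI)
    show "inj_on (shift_key t f) (set v)"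
      using inj_on_shift_key[OF \<open>t \<ge> 1\<close> f_less] set by simp
    fix x y
    assume xy: "x \<in> set v" "y \<in> set v" "pos v x < pos v y"
    then have "x \<noteq> y" by auto
    then show "shift_key t f x < shift_key t f y"
      using xy inv[of x y] inv[of y x] shift_key_compare[of t s f x y, OF \<open>t \<ge> 1\<close> f_less]
        shift_key_compare[of t s f y x, OF \<open>t \<ge> 1\<close> f_less] set
      by (cases x y rule: linorder_cases) auto
  qed (use dist set in \<open>simp_all add: atLeastLessThanSuc_atLeastAtMost del: upt_Suc\<close>)
  moreover have "f \<in> {1..<s} \<rightarrow>\<^sub>E {..<t}"
    using g_less by (auto simp: f_def)
  ultimately show ?thesis
    unfolding comb_listing_def by blast
qed

text \<open>If \<open>f c < g c\<close>, then \<open>c * t + 1 - g c\<close>, the farthest element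
  that \<open>c * t + 1\<close> passes under \<open>g\<close>, is not passed under \<open>f\<close>,
  so the listings differ.\<close>

lemma inj_on_comb_listing:
  assumes "t \<ge> 1"
  shows "inj_on (comb_listing s t) ({1..<s} \<rightarrow>\<^sub>E {..<t})"
proof (rule inj_onI)
  have le: "g c \<le> f c"
    if f: "f \<in> {1..<s} \<rightarrow>\<^sub>E {..<t}" and g: "g \<in> {1..<s} \<rightarrow>\<^sub>E {..<t}"
      and eq: "comb_listing s t f = comb_listing s t g" and c: "c \<in> {1..<s}" for f g c
  proof (rule ccontr)
    assume less: "\<not> g c \<le> f c"
    let ?y = "c * t + 1" and ?x = "c * t + 1 - g c"
    have "g c < t" using g c by auto
    moreover have "t \<le> c * t" using c by simp
    moreover have y: "?y \<in> {1..s * t}" using spine_in_carrier[OF assms] c by simp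
    ultimately have x: "?x \<in> {1..s * t}" "?x < ?y" "?y = ?x + g c"
      using less unfolding atLeastAtMost_iff by linarith+
    have "shifted s t g ?x ?y"
      using c x(3) by (auto simp: shifted_def)
    then have "shifted s t f ?x ?y"
      using pos_comb_listing_inversion[of t s f ?x ?y] pos_comb_listing_inversion[of t s g ?x ?y]
        assms f g x y eq by (auto simp: PiE_iff)
    then have "?y \<le> ?x + f c"
      using assms by (auto simp: shifted_def)
    then show False using less x(3) by linarith
  qed
  fix f g
  assume "f \<in> {1..<s} \<rightarrow>\<^sub>E {..<t}" "g \<in> {1..<s} \<rightarrow>\<^sub>E {..<t}"
    and "comb_listing s t f = comb_listing s t g"
  then show "f = g"
    using le[of f g] le[of g f] by (intro PiE_ext[of f _ _ g] antisym) auto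
qed

theorem theorem21:
  fixes s t :: nat
  assumes "s \<ge> 1" and "t \<ge> 1"
  shows "card {v :: nat list. linear_extension (comb_carrier s t) (comb_order s t) v
                 \<and> avoids v [2, 3, 1] \<and> avoids v [3, 2, 1]} = t ^ (s - 1)"
proof -
  have "{v. admissible s t v} = comb_listing s t ` ({1..<s} \<rightarrow>\<^sub>E {..<t})"
    using admissible_imp_comb_listing[OF \<open>t \<ge> 1\<close>] admissible_comb_listing[OF \<open>t \<ge> 1\<close>]
    by (auto simp: PiE_iff)
  then have "card {v. admissible s t v} = card ({1..<s} \<rightarrow>\<^sub>E {..<t})"
    using card_image[OF inj_on_comb_listing[OF \<open>t \<ge> 1\<close>]] by metis
  \<comment> \<open>Each of the \<open>s - 1\<close> spine elements other than the root has
    \<open>t\<close> possible shifts, chosen independently.\<close>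
  also have "\<dots> = t ^ (s - 1)"
    by (simp add: card_PiE)
  finally show ?thesis
    by (simp add: admissible_def)
qed

end
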